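(* Let $\delta$ be a positive integer and let $D$ be a finite digraph with girth $g$ and $\delta^+(D)\geq\delta$. Then $D$ contains a directed path of length at least $2\delta\left(1-\frac{1}{g}\right)$.
   Context: A digraph has arcs that are ordered pairs of vertices. $\delta^+(D)$ is the minimum out-degree of $D$. The girth is the minimum length of a directed cycle. The length of a path is its number of arcs. *)

theory Defs
  imports
    Complex_Main
    "HOL-Library.Extended_Nat"
    "Graph_Theory.Graph_Theory"
begin

text \<open>
  \<open>Min\<close> is unspecified on the empty set, so this is meaningful only for finite digraphs with
  at least one vertex.
\<close>
definition min_out_degree :: "('a, 'b) pre_digraph \<Rightarrow> nat" where
  "min_out_degree G = Min (out_degree G ` verts G)"

text \<open>
  A cycle is given by its list of arcs, so its length is the length of that list. Loops are
  cycles of length 1, pairs of opposite arcs are cycles of length 2, and the girth of an acyclic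
  digraph is \<open>\<infinity>\<close>.
\<close>
definition girth :: "('a, 'b) pre_digraph \<Rightarrow> enat" where
  "girth G = (INF p \<in> {p. pre_digraph.cycle G p}. enat (length p))"

end

theory Submission
  imports Defs
begin

text \<open>
  The proof is by contradiction and has two ingredients. By an argument of Chvatal and Szemeredi,
  a digraph on \<open>s\<close> vertices with minimum out-degree at least \<open>k \<ge> 1\<close> has a closed walk of length
  \<open>m\<close> with \<open>m (k + 1) \<le> 2 s\<close>. Secondly, if a longest path has length \<open>l < 2 \<delta>\<close>, then some set \<open>S\<close> of
  at most \<open>\<delta>\<close> vertices induces minimum out-degree at least \<open>2 \<delta> - l\<close> (or \<open>l + 1\<close> vertices induce
  minimum out-degree at least \<open>\<delta>\<close>); applying the first fact to \<open>S\<close> contradicts the girth.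

  To find \<open>S\<close>, pass to a minimal nonempty set closed under out-neighbours, which is strongly
  connected. Among longest paths choose one, \<open>us @ cs\<close>, whose end closes up to a cycle \<open>cs\<close> with \<open>us\<close>
  as short as possible. Let \<open>w\<close> be the last vertex of \<open>us\<close>. All out-neighbours of \<open>w\<close> lie on the
  path: otherwise a maximal path through \<open>us\<close> that avoids \<open>cs\<close> ends in a second cycle, and two
  disjoint cycles on more than \<open>\<delta>\<close> vertices each can be joined to a path that is too long. If \<open>x\<close> is
  the predecessor on \<open>cs\<close> of an out-neighbour of \<open>w\<close>, then rotating \<open>cs\<close> gives a longest path ending
  in \<open>x\<close>, so all out-neighbours of \<open>x\<close> lie on \<open>cs\<close>. These \<open>x\<close> make up \<open>S\<close>.
\<close>

section \<open>Directed paths and cycles as vertex lists\<close>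

text \<open>No vertex set is attached, so a one-element list is a path for every element of the
  type; membership in the vertex set is carried separately.\<close>

definition dipath :: "'a rel \<Rightarrow> 'a list \<Rightarrow> bool" where
  "dipath R xs \<longleftrightarrow> distinct xs \<and> successively (\<lambda>x y. (x, y) \<in> R) xs"

definition dicycle :: "'a rel \<Rightarrow> 'a list \<Rightarrow> bool" where
  "dicycle R cs \<longleftrightarrow> cs \<noteq> [] \<and> dipath R cs \<and> (last cs, hd cs) \<in> R"

lemma dipath_Cons:
  "dipath R (x # xs) \<longleftrightarrow> x \<notin> set xs \<and> dipath R xs \<and> (xs = [] \<or> (x, hd xs) \<in> R)"
  by (auto simp: dipath_def successively_Cons)

lemma dipath_append:
  "dipath R (xs @ ys) \<longleftrightarrow> dipath R xs \<and> dipath R ys \<and> set xs \<inter> set ys = {}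
     \<and> (xs = [] \<or> ys = [] \<or> (last xs, hd ys) \<in> R)"
  by (auto simp: dipath_def successively_append_iff)

lemma dipath_Nil [simp]: "dipath R []"
  by (simp add: dipath_def)

lemma dicycle_swap:
  assumes "dicycle R (xs @ ys)" shows "dicycle R (ys @ xs)"
  using assms by (cases "xs = []"; cases "ys = []") (auto simp: dicycle_def dipath_append)

lemma dicycle_rotate_hd:
  assumes "dicycle R cs" "x \<in> set cs"
  obtains rs where "dicycle R rs" "set rs = set cs" "length rs = length cs" "hd rs = x"
proof -
  obtain us ws where cs: "cs = us @ x # ws" using assms(2) by (auto dest: split_list)
  show thesis
    by (rule that[of "(x # ws) @ us"]) (use assms dicycle_swap[of R us "x # ws"] cs in auto)
qed

lemma dicycle_rotate_nth:
  assumes "dicycle R cs" "i < length cs"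
  obtains rs where "dicycle R rs" "set rs = set cs" "length rs = length cs"
    "last rs = cs ! i" "hd rs = cs ! (Suc i mod length cs)"
proof -
  have cs: "cs = take (Suc i) cs @ drop (Suc i) cs" by simp
  let ?rs = "drop (Suc i) cs @ take (Suc i) cs"
  have ne: "cs \<noteq> []" "take (Suc i) cs \<noteq> []" using assms(2) by auto
  have "dicycle R ?rs" by (rule dicycle_swap) (use assms cs in simp)
  moreover have "set ?rs = set cs" using cs by (metis set_append sup_commute)
  moreover have "length ?rs = length cs" by simp
  moreover have "last ?rs = cs ! i" using assms(2) by (simp add: take_Suc_conv_app_nth)
  moreover have "hd ?rs = cs ! (Suc i mod length cs)"
  proof (cases "Suc i < length cs")
    case True then show ?thesis by (simp add: hd_drop_conv_nth hd_append)
  next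
    case False
    then have "Suc i = length cs" using assms(2) by simp
    then show ?thesis using ne by (simp add: hd_conv_nth)
  qed
  ultimately show thesis by (rule that)
qed

lemma dicycle_rotate_last:
  assumes "dicycle R cs" "x \<in> set cs"
  obtains rs where "dicycle R rs" "set rs = set cs" "length rs = length cs" "last rs = x"
  using assms dicycle_rotate_nth by (metis in_set_conv_nth)

text \<open>Build the path from the back of the walk: stop at once if \<open>x\<close> is in
  \<open>B\<close>, keep only the suffix starting at \<open>x\<close> if the path from the next
  vertex meets \<open>x\<close> again, and prepend \<open>x\<close> otherwise. Stopping at the first
  vertex of \<open>B\<close> serves to link two sets, the length bound serves to bound the
  girth.\<close>

lemma relpow_imp_dipath_to_set:
  assumes "(x, y) \<in> R ^^ m" "y \<in> B"
  shows "\<exists>xs. dipath R xs \<and> xs \<noteq> [] \<and> hd xs = x \<and> last xs \<in> B \<and> set (butlast xs) \<inter> B = {}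
           \<and> length xs \<le> Suc m"
  using assms(1)
proof (induction m arbitrary: x)
  case 0
  then show ?case using assms(2) by (intro exI[of _ "[x]"]) (auto simp: dipath_def)
next
  case (Suc m)
  obtain z where z: "(x, z) \<in> R" "(z, y) \<in> R ^^ m" using relpow_Suc_D2[OF Suc.prems] by blast
  obtain xs where xs: "dipath R xs" "xs \<noteq> []" "hd xs = z" "last xs \<in> B"
    "set (butlast xs) \<inter> B = {}" "length xs \<le> Suc m"
    using Suc.IH[OF z(2)] by blast
  consider "x \<in> B" | "x \<notin> B" "x \<in> set xs" | "x \<notin> B" "x \<notin> set xs" by blast
  then show ?case
  proof cases
    case 1
    then show ?thesis by (intro exI[of _ "[x]"]) (auto simp: dipath_def)
  next
    case 2
    obtain us ws where "xs = us @ x # ws" using 2 by (auto dest: split_list)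
    then show ?thesis using xs
      by (intro exI[of _ "x # ws"]) (auto simp: dipath_append butlast_append split: if_splits)
  next
    case 3
    then show ?thesis using xs z(1) by (intro exI[of _ "x # xs"]) (auto simp: dipath_Cons)
  qed
qed

text \<open>Take a path that stops at its first vertex in \<open>B\<close> and drop everything
  before its last vertex in \<open>A\<close>.\<close>

lemma rtrancl_imp_dipath_between:
  assumes "(x, y) \<in> R\<^sup>*" "x \<in> A" "y \<in> B" "A \<inter> B = {}"
  obtains a ts b where "a \<in> A" "b \<in> B" "dipath R (a # ts @ [b])" "set ts \<inter> (A \<union> B) = {}"
proof -
  obtain m where "(x, y) \<in> R ^^ m" using assms(1) rtrancl_imp_relpow by blast
  then obtain xs where xs: "dipath R xs" "xs \<noteq> []" "hd xs = x" "last xs \<in> B"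
    "set (butlast xs) \<inter> B = {}"
    using relpow_imp_dipath_to_set assms(3) by meson
  have "\<exists>z\<in>set xs. z \<in> A" using xs assms(2) by (metis hd_in_set)
  from split_list_last_prop[OF this] obtain us a ws
    where s: "xs = us @ a # ws" "a \<in> A" "\<forall>z\<in>set ws. z \<notin> A" by blast
  have ne: "ws \<noteq> []" using xs(4) s assms(4) by auto
  have ws: "butlast ws @ [last ws] = ws" using ne by simp
  show thesis
  proof (rule that[of a "last ws" "butlast ws"])
    show "dipath R (a # butlast ws @ [last ws])"
      unfolding ws using xs(1) s(1) by (simp add: dipath_append)
    show "set (butlast ws) \<inter> (A \<union> B) = {}"
      using xs(5) s ne by (auto simp: butlast_append dest: in_set_butlastD)
  qed (use xs(4) s ne in auto)
qed

text \<open>Go once around \<open>cs\<close>, ending where a connecting path leaves it, cross over,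
  and go once around \<open>ds\<close> from the point of entry.\<close>

lemma disjoint_dicycles_imp_dipath:
  assumes "dicycle R cs" "dicycle R ds" "set cs \<inter> set ds = {}" "(hd cs, hd ds) \<in> R\<^sup>*"
  obtains xs where "dipath R xs" "length cs + length ds \<le> length xs"
proof -
  have "hd cs \<in> set cs" "hd ds \<in> set ds" using assms by (auto simp: dicycle_def)
  then obtain a ts b where ab: "a \<in> set cs" "b \<in> set ds" "dipath R (a # ts @ [b])"
    "set ts \<inter> (set cs \<union> set ds) = {}"
    using rtrancl_imp_dipath_between[OF assms(4) _ _ assms(3)] by metis
  obtain cs' where cs': "dicycle R cs'" "set cs' = set cs" "length cs' = length cs" "last cs' = a"
    using dicycle_rotate_last[OF assms(1) ab(1)] .
  obtain ds' where ds': "dicycle R ds'" "set ds' = set ds" "length ds' = length ds" "hd ds' = b"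
    using dicycle_rotate_hd[OF assms(2) ab(2)] .
  show thesis
  proof (rule that[of "cs' @ ts @ ds'"])
    show "dipath R (cs' @ ts @ ds')"
      using cs' ds' ab assms(3)
      by (cases "ts = []") (auto simp: dicycle_def dipath_append dipath_Cons hd_append)
  qed (use cs' ds' in auto)
qed

section \<open>Where the last vertex of a path can lead\<close>

text \<open>The cycle is the suffix that starts at the earliest out-neighbour of the last vertex.
  The cardinality bound is strict because the last vertex is on the cycle but is not its own
  out-neighbour.\<close>

lemma dipath_terminal_dicycle:
  assumes "dipath R xs" "xs \<noteq> []" "R `` {last xs} \<subseteq> set xs" "R `` {last xs} \<noteq> {}"
    and irr: "(last xs, last xs) \<notin> R"
  obtains us cs where "xs = us @ cs" "dicycle R cs" "R `` {last xs} \<subseteq> set cs"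
    "card (R `` {last xs}) < length cs"
proof -
  let ?P = "\<lambda>k. k < length xs \<and> (last xs, xs ! k) \<in> R"
  obtain y where "(last xs, y) \<in> R" "y \<in> set xs" using assms by auto
  then obtain k0 where "?P k0" by (metis in_set_conv_nth)
  then have k: "?P (LEAST k. ?P k)" by (rule LeastI)
  define k where "k = (LEAST k. ?P k)"
  have k1: "k < length xs" "(last xs, xs ! k) \<in> R" using k unfolding k_def by auto
  have split: "xs = take k xs @ drop k xs" by simp
  have ne: "drop k xs \<noteq> []" using k1 by simp
  have last: "last (drop k xs) = last xs" using k1 by simp
  have dp: "dipath R (drop k xs)" using assms(1) split by (metis dipath_append)
  have cyc: "dicycle R (drop k xs)"
    using ne last dp k1 by (auto simp: dicycle_def hd_drop_conv_nth)
  have sub: "R `` {last xs} \<subseteq> set (drop k xs)"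
  proof
    fix y assume y: "y \<in> R `` {last xs}"
    then obtain j where j: "j < length xs" "xs ! j = y" using assms(3) by (meson in_set_conv_nth subsetD)
    then have "k \<le> j" unfolding k_def using y by (intro Least_le) auto
    then have "drop k xs ! (j - k) = y" "j - k < length (drop k xs)" using j by auto
    then show "y \<in> set (drop k xs)" by (metis nth_mem)
  qed
  have "last xs \<in> set (drop k xs)" using last ne by (metis last_in_set)
  then have "R `` {last xs} \<subset> set (drop k xs)" using sub irr by auto
  then have "card (R `` {last xs}) < card (set (drop k xs))" by (intro psubset_card_mono) auto
  also have "\<dots> \<le> length (drop k xs)" by (rule card_length)
  finally show thesis using that[OF split cyc sub] by simp
qed

text \<open>Lengths are bounded by \<open>card V\<close>, so a longest extension avoiding
  \<open>X\<close> exists. In the application \<open>X\<close> is a cycle that must stay disjoint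
  from the new path.\<close>

lemma dipath_maximal_extension:
  assumes "finite V" "R \<subseteq> V \<times> V" "dipath R xs" "set xs \<subseteq> V - X"
  obtains zs where "dipath R (xs @ zs)" "set (xs @ zs) \<subseteq> V - X"
    "R `` {last (xs @ zs)} \<subseteq> X \<union> set (xs @ zs)"
proof -
  let ?P = "\<lambda>zs. dipath R (xs @ zs) \<and> set (xs @ zs) \<subseteq> V - X"
  have bound: "length zs < Suc (card V)" if "?P zs" for zs
  proof -
    have "length zs \<le> card (set (xs @ zs))"
      using that by (simp add: dipath_def distinct_card[of "xs @ zs", simplified])
    also have "\<dots> \<le> card V" using that assms(1) by (intro card_mono) auto
    finally show ?thesis by simp
  qed
  have "?P []" using assms by simp
  from ex_has_greatest_nat[of ?P, OF this] bound obtain zs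
    where zs: "?P zs" "\<And>ys. ?P ys \<Longrightarrow> length ys \<le> length zs" by blast
  have "y \<in> X \<union> set (xs @ zs)" if y: "(last (xs @ zs), y) \<in> R" for y
  proof (rule ccontr)
    assume "y \<notin> X \<union> set (xs @ zs)"
    then have "dipath R ((xs @ zs) @ [y]) \<and> set ((xs @ zs) @ [y]) \<subseteq> V - X"
      using zs(1) y assms(2) unfolding dipath_append[of R "xs @ zs"] by (auto simp: dipath_Cons)
    then have "?P (zs @ [y])" by simp
    from zs(2)[OF this] show False by simp
  qed
  then show thesis using zs(1) that by blast
qed

lemma longest_dipath_last_closed:
  assumes "R \<subseteq> V \<times> V" "dipath R xs" "set xs \<subseteq> V" "xs \<noteq> []"
    and "\<And>ys. dipath R ys \<Longrightarrow> set ys \<subseteq> V \<Longrightarrow> length ys \<le> length xs"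
  shows "R `` {last xs} \<subseteq> set xs"
proof
  fix y assume y: "y \<in> R `` {last xs}"
  show "y \<in> set xs"
  proof (rule ccontr)
    assume "y \<notin> set xs"
    then have "dipath R (xs @ [y])" "set (xs @ [y]) \<subseteq> V"
      using y assms(1-4) by (auto simp: dipath_append dipath_Cons)
    from assms(5)[OF this] show False by simp
  qed
qed

section \<open>A set of large induced out-degree on a longest path\<close>

locale strong_digraph_min_outdeg =
  fixes V :: "'a set" and R :: "'a rel" and \<delta> :: nat
  assumes fin: "finite V"
    and sub: "R \<subseteq> V \<times> V"
    and irr: "(x, x) \<notin> R"
    and strong: "x \<in> V \<Longrightarrow> y \<in> V \<Longrightarrow> (x, y) \<in> R\<^sup>*"
    and deg: "x \<in> V \<Longrightarrow> \<delta> \<le> card (R `` {x})"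
    and pos: "0 < \<delta>"
begin

lemma fin_out: "finite (R `` {x})"
  using fin sub by (auto intro: finite_subset)

lemma out_ne: "x \<in> V \<Longrightarrow> R `` {x} \<noteq> {}"
  using deg[of x] pos by auto

lemma terminal_dicycle:
  assumes "dipath R xs" "xs \<noteq> []" "last xs \<in> V" "R `` {last xs} \<subseteq> set xs"
  obtains us cs where "xs = us @ cs" "dicycle R cs" "R `` {last xs} \<subseteq> set cs" "\<delta> < length cs"
  using dipath_terminal_dicycle[OF assms(1,2,4) out_ne[OF assms(3)] irr] deg[OF assms(3)]
  by (metis order_le_less_trans)

text \<open>The second alternative is the case where a longest path closes up to a cycle.\<close>
lemma ex_dense_subset:
  assumes P: "dipath R P" "set P \<subseteq> V" "P \<noteq> []"
    and longest: "\<And>xs. dipath R xs \<Longrightarrow> set xs \<subseteq> V \<Longrightarrow> length xs \<le> length P"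
    and short: "length P \<le> 2 * \<delta>"
  obtains S where "S \<subseteq> V" "S \<noteq> {}" "card S \<le> \<delta>"
      "\<And>x. x \<in> S \<Longrightarrow> 2 * \<delta> + 1 \<le> length P + card (R `` {x} \<inter> S)"
    | S where "S \<subseteq> V" "S \<noteq> {}" "card S = length P" "\<And>x. x \<in> S \<Longrightarrow> \<delta> \<le> card (R `` {x} \<inter> S)"
proof -
  let ?n = "length P"
  \<comment> \<open>A pair in \<open>Q\<close> is a longest path split into a stem \<open>us\<close>
    and a closing cycle \<open>cs\<close>; below, the stem is chosen as short as possible among all
    such pairs.\<close>
  define Q where "Q = (\<lambda>(us, cs). dipath R (us @ cs) \<and> set (us @ cs) \<subseteq> V \<and> length (us @ cs) = ?n
    \<and> dicycle R cs)"
  have last_closed: "R `` {last xs} \<subseteq> set xs"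
    if "dipath R xs" "set xs \<subseteq> V" "length xs = ?n" for xs
  proof -
    have "xs \<noteq> []" using that(3) P(3) by auto
    then show ?thesis
      by (rule longest_dipath_last_closed[OF sub that(1,2)]) (use longest that(3) in simp)
  qed
  have term_Q: "\<exists>us cs. xs = us @ cs \<and> Q (us, cs) \<and> R `` {last xs} \<subseteq> set cs \<and> \<delta> < length cs"
    if xs: "dipath R xs" "set xs \<subseteq> V" "length xs = ?n" for xs
  proof -
    have "xs \<noteq> []" using xs(3) P(3) by auto
    then have "last xs \<in> V" using xs(2) by auto
    from terminal_dicycle[OF xs(1) \<open>xs \<noteq> []\<close> this last_closed[OF xs]]
    obtain us cs where "xs = us @ cs" "dicycle R cs" "R `` {last xs} \<subseteq> set cs" "\<delta> < length cs" .
    then show ?thesis unfolding Q_def using xs by (intro exI[of _ us] exI[of _ cs]) auto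
  qed
  obtain us0 cs0 where "Q (us0, cs0)" using term_Q[OF P(1,2) refl] by blast
  then obtain uc where uc: "Q uc" "\<And>uc'. Q uc' \<Longrightarrow> length (fst uc) \<le> length (fst uc')"
    using ex_has_least_nat[of Q _ "\<lambda>uc. length (fst uc)"] by blast
  obtain us cs where uc_eq: "uc = (us, cs)" by (cases uc)
  have us_min: "length us \<le> length us'" if "Q (us', cs')" for us' cs'
    using uc(2)[OF that] by (simp add: uc_eq)
  have cs: "dipath R (us @ cs)" "set us \<subseteq> V" "set cs \<subseteq> V" "length us + length cs = ?n" "dicycle R cs"
    using uc(1) unfolding uc_eq Q_def by auto
  have dj: "set us \<inter> set cs = {}" and us: "dipath R us" using cs(1) by (auto simp: dipath_append)
  have cs_ne: "cs \<noteq> []" and dcs: "distinct cs" using cs(5) by (auto simp: dicycle_def dipath_def)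
  \<comment> \<open>Replacing \<open>cs\<close> by a rotation that \<open>us\<close> can still enter
    gives another longest path. The cycle at its end has a stem no shorter than \<open>us\<close>,
    so this cycle, and with it every out-neighbour of the new end, lies within
    \<open>rs\<close>.\<close>
  have end_closed: "R `` {last rs} \<subseteq> set cs \<and> \<delta> < length cs"
    if rs: "dicycle R rs" "set rs = set cs" "length rs = length cs" "us = [] \<or> (last us, hd rs) \<in> R" for rs
  proof -
    have "dipath R (us @ rs)" using rs us dj by (auto simp: dipath_append dicycle_def)
    moreover have "set (us @ rs) \<subseteq> V" "length (us @ rs) = ?n" using rs cs by auto
    ultimately obtain us' cs' where *: "us @ rs = us' @ cs'" "Q (us', cs')"
      "R `` {last (us @ rs)} \<subseteq> set cs'" "\<delta> < length cs'" using term_Q by metis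
    have le: "length us \<le> length us'" by (rule us_min[OF *(2)])
    then have "cs' = drop (length us' - length us) rs"
      using *(1) by (metis append_eq_append_conv_if append_eq_conv_conj drop_append diff_is_0_eq
        drop_0 drop_all append_Nil)
    then have "set cs' \<subseteq> set rs" "length cs' \<le> length rs" by (auto dest: in_set_dropD)
    moreover have "last (us @ rs) = last rs" using rs(1) by (simp add: dicycle_def)
    ultimately show ?thesis using * rs by auto
  qed
  have cs_len: "\<delta> < length cs"
    using end_closed[OF cs(5)] cs(1) cs_ne by (auto simp: dipath_append)
  show thesis
  proof (cases "us = []")
    case True
    \<comment> \<open>Without a stem every rotation is allowed, so each vertex of the cycle occurs
      as an end.\<close>
    have "\<delta> \<le> card (R `` {x} \<inter> set cs)" if x: "x \<in> set cs" for x
    proof -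
      obtain rs where "dicycle R rs" "set rs = set cs" "length rs = length cs" "last rs = x"
        using dicycle_rotate_last[OF cs(5) x] .
      then have "R `` {x} \<subseteq> set cs" using end_closed True by blast
      then have "R `` {x} \<inter> set cs = R `` {x}" by blast
      then show ?thesis using deg[of x] x cs(3) by auto
    qed
    then show thesis
      using that(2)[of "set cs"] cs True cs_ne dcs by (auto simp: distinct_card)
  next
    case False
    define w where "w = last us"
    have w: "w \<in> set us" "w \<in> V" using False cs(2) by (auto simp: w_def)
    have w_closed: "R `` {w} \<subseteq> set us \<union> set cs"
    proof (rule ccontr)
      assume "\<not> ?thesis"
      then obtain y where y: "(w, y) \<in> R" "y \<notin> set us" "y \<notin> set cs" by auto
      have "dipath R (us @ [y])" "set (us @ [y]) \<subseteq> V - set cs"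
        using us y sub cs(2) dj by (auto simp: dipath_append dipath_Cons w_def)
      then obtain zs where zs: "dipath R ((us @ [y]) @ zs)" "set ((us @ [y]) @ zs) \<subseteq> V - set cs"
        "R `` {last ((us @ [y]) @ zs)} \<subseteq> set cs \<union> set ((us @ [y]) @ zs)"
        using dipath_maximal_extension[OF fin sub] by metis
      define q where "q = (us @ [y]) @ zs"
      have q: "dipath R q" "set q \<subseteq> V" "set q \<inter> set cs = {}" "R `` {last q} \<subseteq> set cs \<union> set q"
        "length us < length q" "q \<noteq> []" using zs unfolding q_def by auto
      \<comment> \<open>An arc from the end of \<open>q\<close> to \<open>cs\<close> would allow the
        whole cycle to be appended to \<open>q\<close>. Since \<open>q\<close> is longer than
        \<open>us\<close>, this would beat the longest path.\<close>
      have "R `` {last q} \<inter> set cs = {}"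
      proof (rule ccontr)
        assume "\<not> ?thesis"
        then obtain z where z: "(last q, z) \<in> R" "z \<in> set cs" by auto
        obtain rs where "dicycle R rs" "set rs = set cs" "length rs = length cs" "hd rs = z"
          using dicycle_rotate_hd[OF cs(5) z(2)] .
        then have "dipath R (q @ rs)" "set (q @ rs) \<subseteq> V" "length (q @ rs) > ?n"
          using q z cs by (auto simp: dipath_append dicycle_def)
        then show False using longest by (meson not_le)
      qed
      then have "R `` {last q} \<subseteq> set q" using q(4) by blast
      then obtain vs ds where ds: "q = vs @ ds" "dicycle R ds" "\<delta> < length ds"
        using terminal_dicycle[OF q(1,6)] q(2,6) by (metis last_in_set subsetD)
      have "hd cs \<in> V" "hd ds \<in> V" using cs_ne cs(3) ds q(2) by (auto simp: dicycle_def)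
      moreover have "set cs \<inter> set ds = {}" using q(3) ds(1) by auto
      ultimately obtain xs where xs: "dipath R xs" "length cs + length ds \<le> length xs"
        using disjoint_dicycles_imp_dipath[OF cs(5) ds(2)] strong by metis
      \<comment> \<open>In a path with at least two vertices each of them is an end of an arc, hence
        in \<open>V\<close>.\<close>
      have "set xs \<subseteq> V"
      proof
        fix x assume "x \<in> set xs"
        then obtain as bs where ab: "xs = as @ x # bs" by (auto dest: split_list)
        have "length xs \<ge> 2" using xs cs_len ds(3) pos by linarith
        then have "as \<noteq> [] \<or> bs \<noteq> []" using ab by auto
        then show "x \<in> V" using xs(1) ab sub by (auto simp: dipath_append dipath_Cons)
      qed
      from longest[OF xs(1) this] show False using xs(2) cs_len ds(3) short by linarith
    qed
    let ?c = "length cs"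
    \<comment> \<open>Indices of the predecessors, along \<open>cs\<close>, of out-neighbours of
      \<open>w\<close>; \<open>mod\<close> accounts for the arc that closes the cycle.\<close>
    define I where "I = {i. i < ?c \<and> (w, cs ! (Suc i mod ?c)) \<in> R}"
    have finI: "finite I" by (auto simp: I_def)
    have "R `` {w} \<inter> set cs \<subseteq> (\<lambda>i. cs ! (Suc i mod ?c)) ` I"
    proof
      fix y assume y: "y \<in> R `` {w} \<inter> set cs"
      then obtain j where j: "j < ?c" "cs ! j = y" by (auto simp: in_set_conv_nth)
      define i where "i = (if j = 0 then ?c - 1 else j - 1)"
      have "i < ?c" "Suc i mod ?c = j" using j by (auto simp: i_def)
      then show "y \<in> (\<lambda>i. cs ! (Suc i mod ?c)) ` I" using y j by (auto simp: I_def intro!: image_eqI[of _ _ i])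
    qed
    then have "card (R `` {w} \<inter> set cs) \<le> card I"
      using finI by (meson card_image_le card_mono finite_imageI le_trans)
    \<comment> \<open>As \<open>w\<close> is on the stem and has no loop, at most
      \<open>length us - 1\<close> of its out-neighbours are on the stem. This is the source of the
      \<open>+ 1\<close> in \<open>I_card\<close>.\<close>
    moreover have "card (R `` {w}) \<le> card (R `` {w} \<inter> set cs) + card (set us - {w})"
    proof -
      have "R `` {w} \<subseteq> (R `` {w} \<inter> set cs) \<union> (set us - {w})" using w_closed irr by auto
      then have "card (R `` {w}) \<le> card ((R `` {w} \<inter> set cs) \<union> (set us - {w}))"
        by (intro card_mono) auto
      also have "\<dots> \<le> card (R `` {w} \<inter> set cs) + card (set us - {w})" by (rule card_Un_le)
      finally show ?thesis .
    qed
    moreover have "card (set us - {w}) + 1 = length us"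
      using w(1) us by (simp add: dipath_def distinct_card Suc_leI card_gt_0_iff)
        (metis False Suc_pred distinct_card length_greater_0_conv)
    ultimately have I_card: "\<delta> + 1 \<le> card I + length us" using deg[OF w(2)] by linarith
    define T where "T = (!) cs ` I"
    have "inj_on ((!) cs) I" using dcs by (auto simp: I_def inj_on_def nth_eq_iff_index_eq)
    then have T_card: "\<delta> + 1 \<le> card T + length us" using I_card by (simp add: T_def card_image)
    have T_sub: "T \<subseteq> set cs" by (auto simp: T_def I_def)
    have T_out: "R `` {x} \<subseteq> set cs" if "x \<in> T" for x
    proof -
      obtain i where i: "i < ?c" "(w, cs ! (Suc i mod ?c)) \<in> R" "x = cs ! i"
        using \<open>x \<in> T\<close> by (auto simp: T_def I_def)
      obtain rs where "dicycle R rs" "set rs = set cs" "length rs = ?c" "last rs = cs ! i"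
        "hd rs = cs ! (Suc i mod ?c)" using dicycle_rotate_nth[OF cs(5) i(1)] .
      then show ?thesis using end_closed[of rs] i by (auto simp: w_def)
    qed
    have us_len: "length us < \<delta>" using cs(4) cs_len short by linarith
    \<comment> \<open>If \<open>T\<close> has more than \<open>\<delta>\<close> elements, any
      \<open>\<delta>\<close> of them suffice because the stem is nonempty.\<close>
    have "\<exists>S\<subseteq>T. card S \<le> \<delta> \<and> \<delta> + 1 \<le> card S + length us"
    proof (cases "card T \<le> \<delta>")
      case True then show ?thesis using T_card by blast
    next
      case False
      then obtain S where "S \<subseteq> T" "card S = \<delta>" by (meson nat_le_linear obtain_subset_with_card_n)
      then show ?thesis using \<open>us \<noteq> []\<close> by (intro exI[of _ S]) (auto simp: Suc_le_eq)
    qed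
    then obtain S where S: "S \<subseteq> T" "card S \<le> \<delta>" "\<delta> + 1 \<le> card S + length us" by blast
    have "S \<noteq> {}" using S(3) us_len by auto
    \<comment> \<open>All out-neighbours of \<open>x\<close> are on \<open>cs\<close>, and at most
      \<open>?c - card S\<close> of them miss \<open>S\<close>. Combine this with
      \<open>?c = ?n - length us\<close> and the lower bound on \<open>card S\<close>. The additive
      form avoids truncated subtraction.\<close>
    moreover have "2 * \<delta> + 1 \<le> ?n + card (R `` {x} \<inter> S)" if x: "x \<in> S" for x
    proof -
      have xT: "x \<in> T" using x S(1) by blast
      then have xV: "x \<in> V" using T_sub cs(3) by blast
      have finS: "finite S" using S(1) T_sub by (meson List.finite_set finite_subset)
      have "R `` {x} \<subseteq> (R `` {x} \<inter> S) \<union> (set cs - S)" using T_out[OF xT] by blast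
      then have "card (R `` {x}) \<le> card ((R `` {x} \<inter> S) \<union> (set cs - S))"
        using finS by (intro card_mono) auto
      also have "\<dots> \<le> card (R `` {x} \<inter> S) + card (set cs - S)" by (rule card_Un_le)
      also have "card (set cs - S) = ?c - card S"
        using S(1) T_sub finS dcs by (subst card_Diff_subset) (auto simp: distinct_card)
      finally have "card (R `` {x}) \<le> card (R `` {x} \<inter> S) + (?c - card S)" .
      moreover have "card S \<le> ?c" using S(2) cs_len by linarith
      ultimately show ?thesis using deg[OF xV] S(3) cs(4) by linarith
    qed
    ultimately show thesis using that(1)[of S] S T_sub cs(3) by blast
  qed
qed

end

section \<open>Short closed walks from minimum out-degree\<close>

lemma relpow_mono:
  fixes R R' :: "'a rel"
  assumes "(x, y) \<in> R ^^ m" "R \<subseteq> R'" shows "(x, y) \<in> R' ^^ m"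
  using assms by (induction m arbitrary: y) auto

text \<open>Keep the walk up to the tail of its first new arc and from the head of its last one.
  Since all of \<open>X \<times> B\<close> is available, a single new arc \<open>(w, b)\<close>
  bridges the gap; it is the \<open>+ 1\<close> in the length bound.\<close>

lemma relpow_shortcut:
  assumes "(x, y) \<in> R' ^^ m" "R' \<subseteq> R \<union> X \<times> B"
  shows "(x, y) \<in> R ^^ m \<or> (\<exists>i j w b. (x, w) \<in> R ^^ i \<and> w \<in> X \<and> b \<in> B \<and> (b, y) \<in> R ^^ j \<and> i + j + 1 \<le> m)"
  using assms(1)
proof (induction m arbitrary: x)
  case 0
  then show ?case by simp
next
  case (Suc m)
  obtain z where z: "(x, z) \<in> R'" "(z, y) \<in> R' ^^ m" using relpow_Suc_D2[OF Suc.prems] by blast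
  consider "(x, z) \<in> R" | "x \<in> X" "z \<in> B" using z(1) assms(2) by blast
  then show ?case
  proof cases
    case 1
    from Suc.IH[OF z(2)] show ?thesis
    proof
      assume "(z, y) \<in> R ^^ m"
      then show ?thesis using relpow_Suc_I2[OF 1] by blast
    next
      assume "\<exists>i j w b. (z, w) \<in> R ^^ i \<and> w \<in> X \<and> b \<in> B \<and> (b, y) \<in> R ^^ j \<and> i + j + 1 \<le> m"
      then obtain i j w b where *: "(z, w) \<in> R ^^ i" "w \<in> X" "b \<in> B" "(b, y) \<in> R ^^ j" "i + j + 1 \<le> m"
        by blast
      have "(x, w) \<in> R ^^ Suc i" using relpow_Suc_I2[OF 1 *(1)] .
      then show ?thesis using * by (intro disjI2 exI[of _ "Suc i"] exI[of _ j] exI[of _ w] exI[of _ b]) auto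
    qed
  next
    case 2
    from Suc.IH[OF z(2)] show ?thesis
    proof
      assume "(z, y) \<in> R ^^ m"
      then show ?thesis using 2
        by (intro disjI2 exI[of _ 0] exI[of _ m] exI[of _ x] exI[of _ z]) auto
    next
      assume "\<exists>i j w b. (z, w) \<in> R ^^ i \<and> w \<in> X \<and> b \<in> B \<and> (b, y) \<in> R ^^ j \<and> i + j + 1 \<le> m"
      then obtain i j w b where "b \<in> B" "(b, y) \<in> R ^^ j" "i + j + 1 \<le> m" by blast
      then show ?thesis using 2
        by (intro disjI2 exI[of _ 0] exI[of _ j] exI[of _ x] exI[of _ b]) auto
    qed
  qed
qed

text \<open>Double counting: in-degrees and out-degrees both sum to the number of arcs.\<close>

lemma ex_indegree_ge:
  assumes "finite V" "V \<noteq> {}" "R \<subseteq> V \<times> V" "\<And>x. x \<in> V \<Longrightarrow> k \<le> card (R `` {x})"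
  shows "\<exists>v\<in>V. k \<le> card (R\<inverse> `` {v})"
proof (rule ccontr)
  assume "\<not> ?thesis"
  then have lt: "card (R\<inverse> `` {v}) < k" if "v \<in> V" for v using that by auto
  have fR: "finite R" using assms(1,3) by (meson finite_SigmaI finite_subset)
  have "card R = card (SIGMA x:V. R `` {x})" using assms(3) by (intro arg_cong[of _ _ card]) auto
  also have "\<dots> = (\<Sum>x\<in>V. card (R `` {x}))"
    using assms(1) fR by (intro card_SigmaI) (auto intro: finite_Image)
  also have "\<dots> \<ge> (\<Sum>x\<in>V. k)" by (intro sum_mono assms(4))
  finally have 1: "card V * k \<le> card R" by simp
  have "card R = card (R\<inverse>)" by simp
  also have "\<dots> = card (SIGMA x:V. R\<inverse> `` {x})" using assms(3) by (intro arg_cong[of _ _ card]) auto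
  also have "\<dots> = (\<Sum>x\<in>V. card (R\<inverse> `` {x}))"
    using assms(1) fR by (intro card_SigmaI) (auto intro: finite_Image)
  also have "\<dots> < (\<Sum>x\<in>V. k)" using assms(1,2) lt by (intro sum_strict_mono) auto
  finally show False using 1 by simp
qed

text \<open>
  The argument of Chvatal and Szemeredi: for a vertex \<open>v\<close> of in-degree at least \<open>k\<close>, delete \<open>v\<close> and
  its in-neighbours and join every vertex that loses an out-neighbour to all out-neighbours of
  \<open>v\<close>. This removes at least \<open>k + 1\<close> vertices. A new arc stands for a walk of length 3, and a
  closed walk can be shortcut to use at most one new arc, so its length grows by at most 2.
\<close>
lemma ex_short_closed_walk:
  assumes "finite V" "V \<noteq> {}" "R \<subseteq> V \<times> V" "\<And>x. x \<in> V \<Longrightarrow> k \<le> card (R `` {x})" "0 < k"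
  shows "\<exists>x m. 0 < m \<and> (x, x) \<in> R ^^ m \<and> m * (k + 1) \<le> 2 * card V"
  using assms(1-4)
proof (induction "card V" arbitrary: V R rule: less_induct)
  case less
  have fR: "finite (R `` X)" for X using less.prems(1,3) by (auto intro: finite_subset)
  have fRc: "finite (R\<inverse> `` X)" for X using less.prems(1,3) by (auto intro: finite_subset)
  obtain v where v: "v \<in> V" "k \<le> card (R\<inverse> `` {v})"
    using ex_indegree_ge[OF less.prems] by blast
  define A where "A = R\<inverse> `` {v}"
  define B where "B = R `` {v}"
  have AV: "A \<subseteq> V" and BV: "B \<subseteq> V" using less.prems(3) by (auto simp: A_def B_def)
  have kB: "k \<le> card B" using less.prems(4)[OF v(1)] by (simp add: B_def)
  have kV: "k \<le> card V" using kB BV less.prems(1) by (meson card_mono le_trans)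
  \<comment> \<open>A loop or a pair of opposite arcs at \<open>v\<close> is already short enough.
    Otherwise \<open>B\<close> avoids the deleted vertices, so the new arcs stay within
    \<open>W\<close>.\<close>
  consider "(v, v) \<in> R" | "(v, v) \<notin> R" "A \<inter> B \<noteq> {}" | "(v, v) \<notin> R" "A \<inter> B = {}" by blast
  then show ?case
  proof cases
    case 1
    then have "(v, v) \<in> R ^^ 1" by simp
    moreover have "1 * (k + 1) \<le> 2 * card V" using kV \<open>0 < k\<close> by simp
    ultimately show ?thesis by (metis zero_less_one)
  next
    case 2
    then obtain a where a: "(v, a) \<in> R" "(a, v) \<in> R" by (auto simp: A_def B_def)
    then have "(v, v) \<in> R ^^ 2" by (auto simp: numeral_2_eq_2)
    moreover have "k + 1 \<le> card V"
    proof -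
      have "insert v B \<subseteq> V" "v \<notin> B" using v BV 2 by (auto simp: B_def)
      then have "card (insert v B) \<le> card V" using less.prems(1) by (intro card_mono)
      moreover have "card (insert v B) = card B + 1"
        using \<open>v \<notin> B\<close> finite_subset[OF BV less.prems(1)] by simp
      ultimately have "card B + 1 \<le> card V" by simp
      then show ?thesis using kB by linarith
    qed
    then have "2 * (k + 1) \<le> 2 * card V" by simp
    ultimately show ?thesis by (metis zero_less_numeral)
  next
    case 3
    define W where "W = V - insert v A"
    define X where "X = {w \<in> W. R `` {w} \<inter> A \<noteq> {}}"
    define R' where "R' = (R \<inter> W \<times> W) \<union> X \<times> B"
    have BW: "B \<subseteq> W" using BV 3 by (auto simp: W_def B_def)
    have "v \<notin> A" using 3 by (auto simp: A_def)
    then have "card (insert v A) = card A + 1" using finite_subset[OF AV less.prems(1)] by simp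
    moreover have "card (insert v A) + card W = card V"
      unfolding W_def using less.prems(1) AV v(1)
      by (metis card_Diff_subset card_mono finite_subset insert_subset le_add_diff_inverse)
    ultimately have cW: "card W + (k + 1) \<le> card V" using v(2) by (simp add: A_def)
    have "\<exists>x m. 0 < m \<and> (x, x) \<in> R' ^^ m \<and> m * (k + 1) \<le> 2 * card W"
    proof (rule less.hyps)
      show "card W < card V" using cW by simp
      show "finite W" using less.prems(1) by (simp add: W_def)
      show "W \<noteq> {}" using BW kB \<open>0 < k\<close> by auto
      show "R' \<subseteq> W \<times> W" using BW by (auto simp: R'_def X_def)
      fix x assume x: "x \<in> W"
      have fin': "finite (R' `` {x})"
        using \<open>R' \<subseteq> W \<times> W\<close> \<open>finite W\<close> by (auto intro: finite_subset)
      \<comment> \<open>A vertex of \<open>X\<close> has all of \<open>B\<close> as out-neighbours;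
        any other vertex of \<open>W\<close> loses none of its own.\<close>
      show "k \<le> card (R' `` {x})"
      proof (cases "x \<in> X")
        case True
        then have "B \<subseteq> R' `` {x}" by (auto simp: R'_def)
        then show ?thesis using kB fin' by (meson card_mono le_trans)
      next
        case False
        then have "R `` {x} \<subseteq> R' `` {x}"
          using x less.prems(3) by (auto simp: R'_def X_def W_def A_def)
        then have "card (R `` {x}) \<le> card (R' `` {x})" by (rule card_mono[OF fin'])
        moreover have "k \<le> card (R `` {x})" using less.prems(4) x by (simp add: W_def)
        ultimately show ?thesis by (rule order_trans[rotated])
      qed
    qed
    then obtain x m where m: "0 < m" "(x, x) \<in> R' ^^ m" "m * (k + 1) \<le> 2 * card W" by blast
    have "R' \<subseteq> R \<union> X \<times> B" by (auto simp: R'_def)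
    from relpow_shortcut[OF m(2) this] show ?thesis
    proof (elim disjE exE conjE)
      assume "(x, x) \<in> R ^^ m"
      then show ?thesis using m cW by (intro exI[of _ x] exI[of _ m]) auto
    next
      fix i j w b
      assume *: "(x, w) \<in> R ^^ i" "w \<in> X" "b \<in> B" "(b, x) \<in> R ^^ j" "i + j + 1 \<le> m"
      \<comment> \<open>The new arc from \<open>w\<close> to \<open>b\<close> expands to the walk
        through \<open>a\<close> and \<open>v\<close>, so the length is at most
        \<open>m + 2\<close>. The two extra arcs are paid for by the \<open>k + 1\<close> deleted
        vertices, which raise the bound by \<open>2 * (k + 1)\<close>.\<close>
      obtain a where "(w, a) \<in> R" "(a, v) \<in> R" "(v, b) \<in> R" using * by (auto simp: X_def A_def B_def)
      then have "(w, b) \<in> R ^^ 3" by (auto simp: numeral_3_eq_3)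
      then have "(w, w) \<in> R ^^ (3 + (j + i))" using * by (auto simp: relpow_add)
      moreover have "(3 + (j + i)) * (k + 1) \<le> (m + 2) * (k + 1)" using *(5) by (intro mult_right_mono) auto
      moreover have "(m + 2) * (k + 1) \<le> 2 * card V" using m(3) cW by (simp add: algebra_simps)
      ultimately show ?thesis
        by (intro exI[of _ w] exI[of _ "3 + (j + i)"] conjI) (simp, assumption, rule order_trans)
    qed
  qed
qed

section \<open>Reduction to a strongly connected digraph\<close>

text \<open>Take a nonempty closed set of least size: the set reachable from any of its vertices is
  again closed and nonempty, hence is the whole set.\<close>

lemma ex_strong_closed_subset:
  assumes "finite V" "V \<noteq> {}" "R \<subseteq> V \<times> V"
  obtains W where "W \<subseteq> V" "W \<noteq> {}" "R `` W \<subseteq> W"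
    "\<And>x y. x \<in> W \<Longrightarrow> y \<in> W \<Longrightarrow> (x, y) \<in> (R \<inter> W \<times> W)\<^sup>*"
proof -
  let ?P = "\<lambda>W. W \<subseteq> V \<and> W \<noteq> {} \<and> R `` W \<subseteq> W"
  have "?P V" using assms by auto
  from ex_has_least_nat[of ?P V card, OF this]
  obtain W where W: "?P W" "\<And>U. ?P U \<Longrightarrow> card W \<le> card U" by (elim exE conjE) metis
  have fW: "finite W" using W(1) assms(1) finite_subset by blast
  have "(x, y) \<in> (R \<inter> W \<times> W)\<^sup>*" if x: "x \<in> W" and y: "y \<in> W" for x y
  proof -
    define U where "U = (R \<inter> W \<times> W)\<^sup>* `` {x}"
    have "U \<subseteq> W"
    proof
      fix z assume "z \<in> U"
      then have "(x, z) \<in> (R \<inter> W \<times> W)\<^sup>*" by (simp add: U_def)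
      then show "z \<in> W" using x by (induction rule: rtrancl_induct) auto
    qed
    moreover have "R `` U \<subseteq> U"
    proof
      fix z assume "z \<in> R `` U"
      then obtain u where u: "u \<in> U" "(u, z) \<in> R" by auto
      then have "(u, z) \<in> R \<inter> W \<times> W" using \<open>U \<subseteq> W\<close> W(1) by auto
      then show "z \<in> U" using u(1) unfolding U_def by (auto intro: rtrancl_into_rtrancl)
    qed
    moreover have "x \<in> U" by (simp add: U_def)
    ultimately have "?P U" using W(1) by blast
    then have "U = W" using W(2) \<open>U \<subseteq> W\<close> fW by (intro card_seteq) auto
    then show ?thesis using y unfolding U_def by blast
  qed
  then show thesis using that W(1) by blast
qed

section \<open>From vertex lists to arc walks and the girth\<close>

text \<open>In a pair digraph an arc is the pair of its ends, so zipping a vertex list with its tail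
  yields the arcs of the walk.\<close>

lemma pawalk_zip_tl:
  assumes "xs \<noteq> []" "successively (\<lambda>x y. (x, y) \<in> A) xs"
  shows "pcas (hd xs) (zip xs (tl xs)) (last xs)" "pawalk_verts (hd xs) (zip xs (tl xs)) = xs"
    "set (zip xs (tl xs)) \<subseteq> A"
  using assms by (induction xs rule: induct_list012) auto

context pair_wf_digraph
begin

lemma awalk_zip_tl:
  assumes "xs \<noteq> []" "successively (\<lambda>x y. (x, y) \<in> parcs G) xs" "hd xs \<in> pverts G"
  shows "awalk (hd xs) (zip xs (tl xs)) (last xs)"
  unfolding awalk_def using pawalk_zip_tl[OF assms(1,2)] assms(3) by simp

lemma apath_zip_tl:
  assumes "dipath (parcs G) xs" "xs \<noteq> []" "hd xs \<in> pverts G"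
  shows "apath (hd xs) (zip xs (tl xs)) (last xs)"
  using assms awalk_zip_tl[of xs] pawalk_zip_tl(2)[of xs "parcs G"]
  by (simp add: apath_def dipath_def)

text \<open>Split off the first arc, shorten the rest to a path back to \<open>x\<close>, and put
  the arc in front again. The cycle has as many arcs as this path has vertices, at most
  \<open>m\<close>; a loop is included.\<close>

lemma girth_le_closed_walk:
  assumes "(x, x) \<in> parcs G ^^ m" "0 < m"
  shows "girth (with_proj G) \<le> enat m"
proof -
  obtain n where n: "m = Suc n" using assms(2) by (cases m) auto
  obtain z where z: "(x, z) \<in> parcs G" "(z, x) \<in> parcs G ^^ n"
    using assms(1) relpow_Suc_D2 unfolding n by fast
  obtain xs where xs: "dipath (parcs G) xs" "xs \<noteq> []" "hd xs = z" "last xs \<in> {x}" "length xs \<le> m"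
    using relpow_imp_dipath_to_set[OF z(2), of "{x}"] n by auto
  have succ: "successively (\<lambda>x y. (x, y) \<in> parcs G) (x # xs)"
    using xs z(1) by (simp add: successively_Cons dipath_def)
  have "awalk x (zip (x # xs) xs) x"
    using awalk_zip_tl[OF _ succ] xs z(1) in_arcsD1 by auto
  moreover have "distinct (tl (pawalk_verts x (zip (x # xs) xs)))"
    using pawalk_zip_tl(2)[OF _ succ] xs(1) by (simp add: dipath_def)
  ultimately have "cycle (zip (x # xs) xs)" using xs(2) unfolding cycle_def by auto
  then have "girth (with_proj G) \<le> enat (length (zip (x # xs) xs))"
    unfolding girth_def by (intro INF_lower) simp
  also have "\<dots> \<le> enat m" using xs(5) by simp
  finally show ?thesis .
qed

lemma girth_ge_1: "1 \<le> girth (with_proj G)"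
  unfolding girth_def
  by (intro INF_greatest) (auto simp: cycle_def one_enat_def Suc_le_eq)

lemma out_degree_eq: "out_degree (with_proj G) x = card (parcs G `` {x})"
proof -
  have "out_arcs (with_proj G) x = Pair x ` (parcs G `` {x})" by (auto simp: out_arcs_def)
  then show ?thesis by (simp add: out_degree_def card_image inj_on_def)
qed

end

section \<open>Numerical contradiction with the girth\<close>

theorem theorem1:
  fixes D :: "'a pair_pre_digraph" and \<delta> g :: nat
  assumes "pair_fin_digraph D" and "pverts D \<noteq> {}"
    and "\<delta> > 0"
    and "girth (with_proj D) = enat g"
    and "min_out_degree (with_proj D) \<ge> \<delta>"
  shows "\<exists>u p v. pre_digraph.apath (with_proj D) u p v
           \<and> real (length p) \<ge> 2 * real \<delta> * (1 - 1 / real g)"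
proof (rule ccontr)
  assume no_path: "\<not> ?thesis"
  interpret pair_fin_digraph D by (rule assms(1))
  let ?E = "parcs D"
  have E_sub: "?E \<subseteq> pverts D \<times> pverts D" using wellformed' by auto
  have g_pos: "0 < g" using girth_ge_1 assms(4) by (simp add: one_enat_def)
  have g_le: "g \<le> m" if "(x, x) \<in> ?E ^^ m" "0 < m" for x m
    using girth_le_closed_walk[OF that] assms(4) by simp
  have out: "\<delta> \<le> card (?E `` {x})" if "x \<in> pverts D" for x
  proof -
    have "min_out_degree (with_proj D) \<le> out_degree (with_proj D) x"
      unfolding min_out_degree_def using that pair_finite_verts by (intro Min_le) auto
    then show ?thesis using assms(5) by (simp add: out_degree_eq)
  qed
  obtain W where W: "W \<subseteq> pverts D" "W \<noteq> {}" "?E `` W \<subseteq> W"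
    "\<And>x y. x \<in> W \<Longrightarrow> y \<in> W \<Longrightarrow> (x, y) \<in> (?E \<inter> W \<times> W)\<^sup>*"
    using ex_strong_closed_subset[OF pair_finite_verts assms(2) E_sub] by metis
  define R where "R = ?E \<inter> W \<times> W"
  have RE: "R \<subseteq> ?E" and R_sub: "R \<subseteq> W \<times> W" by (auto simp: R_def)
  have fin_W: "finite W" using W(1) pair_finite_verts finite_subset by blast
  have R_out: "R `` {x} = ?E `` {x}" if "x \<in> W" for x using that W(3) by (auto simp: R_def)
  \<comment> \<open>The assumed bound on the number of arcs, \<open>length xs - 1\<close>, with the
    denominator \<open>g\<close> cleared and no subtraction left.\<close>
  have short: "length xs * g + 2 * \<delta> < 2 * \<delta> * g + g"
    if xs: "dipath R xs" "set xs \<subseteq> W" "xs \<noteq> []" for xs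
  proof -
    have "dipath ?E xs"
      using xs(1) RE by (auto simp: dipath_def elim!: successively_mono)
    moreover have "hd xs \<in> pverts D" using hd_in_set[OF xs(3)] xs(2) W(1) by blast
    ultimately have "apath (hd xs) (zip xs (tl xs)) (last xs)" using apath_zip_tl xs(3) by blast
    with no_path have "real (length (zip xs (tl xs))) < 2 * real \<delta> * (1 - 1 / real g)"
      by (meson not_le)
    then have "real (length xs - 1) * real g < 2 * real \<delta> * (1 - 1 / real g) * real g"
      using g_pos by simp
    also have "\<dots> = 2 * real \<delta> * real g - 2 * real \<delta>" using g_pos by (simp add: field_simps)
    finally have "real ((length xs - 1) * g + 2 * \<delta>) < real (2 * \<delta> * g)" by simp
    then have "(length xs - 1) * g + 2 * \<delta> < 2 * \<delta> * g" by linarith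
    moreover have "length xs * g = (length xs - 1) * g + g" using xs(3) by (cases xs) auto
    ultimately show ?thesis by linarith
  qed
  \<comment> \<open>For \<open>g = 1\<close> the claimed length is 0, which a single vertex attains.
    So loops are excluded from here on.\<close>
  have g2: "2 \<le> g"
  proof -
    obtain x where "x \<in> W" using W(2) by blast
    then have "1 * g + 2 * \<delta> < 2 * \<delta> * g + g" using short[of "[x]"] by (simp add: dipath_Cons)
    then have "g \<noteq> 1" by auto
    then show ?thesis using g_pos by linarith
  qed
  interpret strong_digraph_min_outdeg W R \<delta>
  proof
    fix x show "(x, x) \<notin> R" using g_le[of x 1] g2 RE by auto
  qed (use fin_W R_sub W R_out out assms(3) in \<open>auto simp: R_def\<close>)
  obtain P where P: "dipath R P" "set P \<subseteq> W" "P \<noteq> []"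
    and longest: "\<And>xs. dipath R xs \<Longrightarrow> set xs \<subseteq> W \<Longrightarrow> length xs \<le> length P"
  proof -
    let ?P = "\<lambda>xs. dipath R xs \<and> set xs \<subseteq> W"
    obtain x where x: "x \<in> W" using W(2) by blast
    then have Px: "?P [x]" by (simp add: dipath_Cons)
    have "length xs < Suc (card W)" if "?P xs" for xs
      using that fin_W by (metis card_mono dipath_def distinct_card le_imp_less_Suc)
    then obtain P where "?P P" "\<And>xs. ?P xs \<Longrightarrow> length xs \<le> length P"
      using ex_has_greatest_nat[of ?P "[x]" length, OF Px] by blast
    moreover from this(2)[OF Px] have "P \<noteq> []" by auto
    ultimately show thesis using that by blast
  qed
  \<comment> \<open>\<open>length P\<close> counts vertices, whereas \<open>l\<close> counts
    arcs.\<close>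
  obtain l where l: "length P = Suc l" using P(3) by (cases P) auto
  have lg: "l * g + 2 * \<delta> < 2 * \<delta> * g" using short[OF P] l by simp
  then have "l * g < 2 * \<delta> * g" by linarith
  then have l_less: "l < 2 * \<delta>" by simp
  have closed_walk: "g * (k + 1) \<le> 2 * card S"
    if S: "S \<subseteq> W" "S \<noteq> {}" "\<And>x. x \<in> S \<Longrightarrow> k \<le> card (R `` {x} \<inter> S)" "0 < k" for S k
  proof -
    have "(R \<inter> S \<times> S) `` {x} = R `` {x} \<inter> S" if "x \<in> S" for x using that by auto
    then obtain x m where m: "0 < m" "(x, x) \<in> (R \<inter> S \<times> S) ^^ m" "m * (k + 1) \<le> 2 * card S"
      using ex_short_closed_walk[of S "R \<inter> S \<times> S" k] S fin_W finite_subset by (metis Int_lower2)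
    have "(x, x) \<in> ?E ^^ m" using relpow_mono[OF m(2)] RE by blast
    then have "g * (k + 1) \<le> m * (k + 1)" using g_le m(1) by (intro mult_right_mono) auto
    then show ?thesis using m(3) by linarith
  qed
  show False
  proof (rule ex_dense_subset[OF P longest])
    show "length P \<le> 2 * \<delta>" using l l_less by simp
  next
    fix S assume S: "S \<subseteq> W" "S \<noteq> {}" "card S \<le> \<delta>"
      "\<And>x. x \<in> S \<Longrightarrow> 2 * \<delta> + 1 \<le> length P + card (R `` {x} \<inter> S)"
    obtain k where k: "2 * \<delta> = l + k" "0 < k" using l_less less_imp_add_positive by metis
    have "k \<le> card (R `` {x} \<inter> S)" if "x \<in> S" for x using S(4)[OF that] k l by linarith
    \<comment> \<open>Here \<open>2 * card S\<close> is at most \<open>2 * \<delta> = l + k\<close>,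
      while \<open>lg\<close> amounts to \<open>l + k < k * g\<close>.\<close>
    from closed_walk[OF S(1,2) this k(2)] have "g * (k + 1) \<le> l + k" using S(3) k(1) by linarith
    moreover have "l * g + (l + k) < (l + k) * g" using lg k(1) by simp
    ultimately show False by (simp add: algebra_simps)
  next
    fix S assume S: "S \<subseteq> W" "S \<noteq> {}" "card S = length P"
      "\<And>x. x \<in> S \<Longrightarrow> \<delta> \<le> card (R `` {x} \<inter> S)"
    from closed_walk[OF S(1,2,4) assms(3)] have "g * (\<delta> + 1) \<le> 2 * (l + 1)" using S(3) l by simp
    then have "g * (g * (\<delta> + 1)) \<le> g * (2 * (l + 1))" by (rule mult_le_mono2)
    then have "int g * (int g * (int \<delta> + 1)) \<le> int g * (2 * (int l + 1))"
      by (metis (mono_tags) of_nat_1 of_nat_add of_nat_le_iff of_nat_mult of_nat_numeral)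
    moreover have "int l * int g + 2 * int \<delta> < 2 * int \<delta> * int g"
      using lg by (metis (mono_tags) of_nat_add of_nat_less_iff of_nat_mult of_nat_numeral)
    \<comment> \<open>Multiplying the walk bound by \<open>g\<close> and inserting the bound on
      \<open>l * g\<close> gives \<open>\<delta> * (g - 2)^2 + g * (g - 2) < 0\<close>, which is
      impossible for \<open>g \<ge> 2\<close>. The integers are used for the sake of these
      differences.\<close>
    moreover have "0 \<le> int \<delta> * (int g - 2)\<^sup>2" "0 \<le> int g * (int g - 2)" using g2 by auto
    ultimately show False by (simp add: algebra_simps power2_eq_square)
  qed
qed

end
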